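(* Let $q$ be a power of a prime $p$. If there exists an $((n,K,R,d))_q$ subsystem code with $K>p$ that is pure to $d'$, then there exists an $((n,K/p,pR,\ge d))_q$ subsystem code that is pure to $\min\{d,d'\}$. If a pure $((n,p,R,d))_q$ subsystem code exists, then there exists an $((n,1,pR,d))_q$ subsystem code.
   Context: For $(x|y)\in\mathbf{F}_q^{2n}$ (with $x,y\in\mathbf{F}_q^n$), $\mathrm{swt}(x|y)$ is the number of $i$ with $(x_i,y_i)\ne(0,0)$, and $\mathrm{swt}(S)$ is the minimum of $\mathrm{swt}$ over the nonzero elements of $S$. The trace-symplectic product of $(a|b)$ and $(a'|b')$ is $\mathrm{tr}_{q/p}(a'\cdot b-a\cdot b')$, and $C^{\perp_s}$ is the dual of $C\subseteq\mathbf{F}_q^{2n}$ with respect to it. All subsystem codes are Clifford subsystem codes: an $((n,K,R,d))_q$ subsystem code is a subspace $Q=A\otimes B$ of $\mathbf{C}^{q^n}$, $\dim A=K$, $\dim B=R$, arising from an additive code; concretely, its existence means that there is an additive subgroup $C\le\mathbf{F}_q^{2n}$ (the zero code is allowed) with $D=C\cap C^{\perp_s}$ such that $|C|=q^nR/K$, $|D|=q^n/(KR)$, and $d=\mathrm{swt}(D^{\perp_s}\setminus C)$ if $D^{\perp_s}\ne C$, while $d=\mathrm{swt}(D^{\perp_s})$ if $D^{\perp_s}=C$ (the case $K=1$). Writing $\ge d$ in the last position means that the minimum distance is some $\tilde d\ge d$. The code derived from $C$ is pure to $d'$ if $C$ contains no nonzero element of symplectic weight less than $d'$; it is pure if it is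 pure to its minimum distance $d$. *)

theory Defs
  imports
    "HOL-Analysis.Finite_Cartesian_Product"
    "HOL-Computational_Algebra.Primes"
begin

text \<open>
  The alphabet is a finite field \<open>'a\<close> with \<open>q = CARD('a)\<close> and \<open>p = CHAR('a)\<close>; the length is
  \<open>n = CARD('n)\<close>. A vector \<open>(x|y)\<close> of length \<open>2n\<close> is the pair \<open>(x, y)\<close>.
\<close>

text \<open>
  If \<open>q = p ^ m\<close>, then \<open>tr(x) = x + x ^ p + \<dots> + x ^ (p ^ (m - 1))\<close>, as an element of the prime
  subfield inside \<open>'a\<close>; the exponent \<open>m\<close> is recovered as the multiplicity of \<open>p\<close> in \<open>q\<close>.
\<close>

definition field_trace :: "'a::finite_field \<Rightarrow> 'a" where
  "field_trace x = (\<Sum>i<multiplicity CHAR('a) CARD('a). x ^ (CHAR('a) ^ i))"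

definition trace_symplectic ::
    "('a::finite_field ^ 'n) \<times> ('a ^ 'n) \<Rightarrow> ('a ^ 'n) \<times> ('a ^ 'n) \<Rightarrow> 'a" where
  "trace_symplectic u v =
     field_trace (scalar_product (fst v) (snd u) - scalar_product (fst u) (snd v))"

definition symplectic_dual ::
    "(('a::finite_field ^ 'n) \<times> ('a ^ 'n)) set \<Rightarrow> (('a ^ 'n) \<times> ('a ^ 'n)) set" where
  "symplectic_dual C = {v. \<forall>u\<in>C. trace_symplectic u v = 0}"

definition swt :: "('a::zero ^ 'n) \<times> ('a ^ 'n) \<Rightarrow> nat" where
  "swt v = card {i. (fst v $ i, snd v $ i) \<noteq> (0, 0)}"

text \<open>
  Only meaningful if \<open>S\<close> has a nonzero element; this is the case for every set whose minimum weight
  is taken below, since the length \<open>CARD('n)\<close> is positive.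
\<close>

definition min_swt :: "(('a::{zero,finite} ^ 'n) \<times> ('a ^ 'n)) set \<Rightarrow> nat" where
  "min_swt S = Min (swt ` (S - {0}))"

definition additive_code :: "(('a::ab_group_add ^ 'n) \<times> ('a ^ 'n)) set \<Rightarrow> bool" where
  "additive_code C \<longleftrightarrow> 0 \<in> C \<and> (\<forall>u\<in>C. \<forall>v\<in>C. u + v \<in> C) \<and> (\<forall>u\<in>C. - u \<in> C)"

definition symplectic_radical ::
    "(('a::finite_field ^ 'n) \<times> ('a ^ 'n)) set \<Rightarrow> (('a ^ 'n) \<times> ('a ^ 'n)) set" where
  "symplectic_radical C = C \<inter> symplectic_dual C"

definition code_distance :: "(('a::finite_field ^ 'n) \<times> ('a ^ 'n)) set \<Rightarrow> nat" where
  "code_distance C =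
     (let D' = symplectic_dual (symplectic_radical C)
      in if D' \<noteq> C then min_swt (D' - C) else min_swt D')"

text \<open>
  The additive code \<open>C\<close> gives rise to an \<open>((n, K, R, d))\<close> Clifford subsystem code. The two
  cardinality equations force \<open>K\<close> and \<open>R\<close> to be positive.
\<close>

definition subsystem_code ::
    "(('a::finite_field ^ 'n) \<times> ('a ^ 'n)) set \<Rightarrow> nat \<Rightarrow> nat \<Rightarrow> nat \<Rightarrow> bool" where
  "subsystem_code C K R d \<longleftrightarrow>
     additive_code C \<and>
     real (card C) = real CARD('a) ^ CARD('n) * real R / real K \<and>
     real (card (symplectic_radical C)) = real CARD('a) ^ CARD('n) / (real K * real R) \<and>
     d = code_distance C"

definition pure_to :: "(('a::zero ^ 'n) \<times> ('a ^ 'n)) set \<Rightarrow> nat \<Rightarrow> bool" where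
  "pure_to C d' \<longleftrightarrow> (\<forall>v\<in>C. v \<noteq> 0 \<longrightarrow> d' \<le> swt v)"

definition pure_code :: "(('a::finite_field ^ 'n) \<times> ('a ^ 'n)) set \<Rightarrow> bool" where
  "pure_code C \<longleftrightarrow> pure_to C (code_distance C)"

end

theory Submission
  imports
    Defs
    "HOL-Computational_Algebra.Polynomial"
    "HOL-Number_Theory.Cong"
begin

text \<open>
  Let \<open>D\<close> be the radical of \<open>C\<close>. The cardinality conditions give \<open>K\<^sup>2 |C| |D| = q ^ (2 n)\<close>, so
  \<open>K\<close> is a power of \<open>p\<close>. The trace-symplectic form is nondegenerate, hence
  \<open>|C| |dual C| = q ^ (2 n)\<close>, and it induces a nondegenerate form on \<open>dual C / D\<close>, which has \<open>K\<^sup>2\<close> elements. Adjoining a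
  hyperbolic pair of \<open>dual C\<close> to \<open>C\<close> multiplies \<open>|C|\<close> by \<open>p\<^sup>2\<close> and preserves \<open>D\<close>; the new
  code lies between \<open>C\<close> and \<open>dual D\<close>, so its new elements have weight at least \<open>d\<close>. For \<open>K = p\<close>
  the new code is all of \<open>dual D\<close>, whose minimum weight is \<open>d\<close> by purity.
\<close>

section \<open>The prime subfield and kernels of additive maps into it\<close>

lemma of_nat_power_CHAR: "(of_nat k :: 'a::finite_field) ^ CHAR('a) = of_nat k"
  by (induction k) (simp_all add: freshmans_dream zero_power)

text \<open>For p the characteristic, the polynomial X^p - X has at most p roots, and the p distinct
  elements \<open>of_nat k\<close> are already roots.\<close>

lemma prime_field_eq: "{x :: 'a::finite_field. x ^ CHAR('a) = x} = of_nat ` {..<CHAR('a)}"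
  and card_prime_field: "card {x :: 'a::finite_field. x ^ CHAR('a) = x} = CHAR('a)"
proof -
  let ?p = "CHAR('a)"
  define P where "P = monom (1::'a) ?p - monom 1 1"
  have p2: "?p \<ge> 2"
    using CHAR_prime[where ?'a = 'a] prime_ge_2_nat by blast
  have "coeff P ?p = 1"
    using p2 by (simp add: P_def)
  then have P0: "P \<noteq> 0"
    by auto
  have roots: "{x :: 'a. x ^ ?p = x} = {x. poly P x = 0}"
    by (simp add: P_def poly_monom)
  have "degree P \<le> ?p"
    unfolding P_def using p2
    by (intro degree_diff_le) (simp_all add: degree_monom_eq)
  then have le: "card {x :: 'a. x ^ ?p = x} \<le> ?p"
    unfolding roots using card_poly_roots_bound[OF P0] by linarith
  have "inj_on (of_nat :: nat \<Rightarrow> 'a) {..<?p}"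
    by (auto simp: inj_on_def of_nat_eq_iff_cong_CHAR cong_def)
  then have card: "card ((of_nat :: nat \<Rightarrow> 'a) ` {..<?p}) = ?p"
    by (simp add: card_image)
  have sub: "of_nat ` {..<?p} \<subseteq> {x :: 'a. x ^ ?p = x}"
    by (auto simp: of_nat_power_CHAR)
  show eq: "{x :: 'a. x ^ ?p = x} = of_nat ` {..<?p}"
    using card_seteq[OF _ sub] le card by simp
  show "card {x :: 'a. x ^ ?p = x} = ?p"
    unfolding eq by (fact card)
qed

text \<open>One nonzero value makes \<open>f\<close> map onto the prime subfield, and its fibres are
  translates of the kernel. This index count stands in for dimension arguments, since codes need not
  be linear over \<open>'a\<close>.\<close>

lemma card_additive_code_eq_kernel:
  fixes H :: "(('a::finite_field ^ 'n::finite) \<times> ('a ^ 'n)) set"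
  assumes H: "additive_code H"
    and add: "\<And>u v. f (u + v) = f u + f v"
    and prime_field: "\<And>u. f u ^ CHAR('a) = (f u :: 'a)"
    and w: "w \<in> H" "f w \<noteq> 0"
  shows "card H = CHAR('a) * card {v\<in>H. f v = 0}"
proof -
  have f0: "f 0 = 0"
    using add[of 0 0] by (metis add.right_neutral add_left_cancel)
  have diff: "f (u - v) = f u - f v" for u v
    using add[of "u - v" v] by simp
  have Hadd: "u + v \<in> H" if "u \<in> H" "v \<in> H" for u v
    using H that by (simp add: additive_code_def)
  have Hdiff: "u - v \<in> H" if "u \<in> H" "v \<in> H" for u v
    using Hadd[of u "- v"] H that by (simp add: additive_code_def)
  have mult: "of_nat k * f w \<in> f ` H" for k
  proof (induction k)
    case 0
    have "0 \<in> H"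
      using H by (simp add: additive_code_def)
    then show ?case
      using f0 by force
  next
    case (Suc k)
    then obtain h where "h \<in> H" "of_nat k * f w = f h"
      by auto
    then have "of_nat (Suc k) * f w = f (h + w)" "h + w \<in> H"
      using w Hadd by (simp_all add: add algebra_simps)
    then show ?case
      by blast
  qed
  have image: "f ` H = {x. x ^ CHAR('a) = x}"
  proof (intro equalityI subsetI)
    fix x :: 'a assume "x \<in> {x. x ^ CHAR('a) = x}"
    then have "x / f w \<in> {x. x ^ CHAR('a) = x}"
      by (simp add: power_divide prime_field)
    then obtain k where "x / f w = of_nat k"
      unfolding prime_field_eq by auto
    then have "x = of_nat k * f w"
      using w by (simp add: field_simps)
    then show "x \<in> f ` H"
      using mult by simp
  qed (use prime_field in auto)
  have fibre: "card {v\<in>H. f v = b} = card {v\<in>H. f v = 0}" if b: "b \<in> f ` H" for b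
  proof -
    from b obtain h where h: "h \<in> H" "f h = b"
      by auto
    show ?thesis
      by (rule bij_betw_same_card[of "\<lambda>v. v - h"],
          rule bij_betwI[where g = "\<lambda>v. v + h"])
        (use h Hadd Hdiff in \<open>auto simp: add diff\<close>)
  qed
  have "card H = (\<Sum>b\<in>f ` H. card {v\<in>H. f v = b})"
    using sum.image_gen[of H "\<lambda>_. 1 :: nat" f] by simp
  also have "\<dots> = card (f ` H) * card {v\<in>H. f v = 0}"
    using fibre by simp
  finally show ?thesis
    by (simp add: image card_prime_field)
qed

text \<open>Translation by 1 permutes the field, so adding \<open>CARD('a)\<close> copies of 1
  leaves the sum of all elements unchanged.\<close>

lemma CHAR_dvd_CARD: "CHAR('a::finite_field) dvd CARD('a)"
proof -
  have "(\<Sum>x\<in>UNIV. x + 1) = (\<Sum>x\<in>UNIV. x :: 'a)"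
    by (rule sum.reindex_bij_witness[of _ "\<lambda>x. x - 1" "\<lambda>x. x + 1"]) auto
  then show ?thesis
    by (simp add: sum.distrib flip: of_nat_eq_0_iff_char_dvd)
qed

section \<open>Formal rules for the trace, the trace-symplectic form, duals and minimum
  weights\<close>

lemma field_trace_add: "field_trace (x + y) = field_trace x + field_trace (y :: 'a::finite_field)"
  by (simp add: field_trace_def freshmans_dream' sum.distrib)

lemma field_trace_0 [simp]: "field_trace (0 :: 'a::finite_field) = 0"
  by (simp add: field_trace_def zero_power)

lemma field_trace_minus: "field_trace (- x) = - field_trace (x :: 'a::finite_field)"
  using field_trace_add[of x "- x"] by (simp add: eq_neg_iff_add_eq_0 add.commute)

lemma trace_symplectic_add_right:
  "trace_symplectic u (v + w) = trace_symplectic u v + trace_symplectic u w"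
  unfolding trace_symplectic_def field_trace_add[symmetric]
  by (rule arg_cong[of _ _ field_trace])
     (simp add: scalar_product_def algebra_simps sum.distrib)

lemma trace_symplectic_swap: "trace_symplectic u v = - trace_symplectic v u"
  by (simp add: trace_symplectic_def flip: field_trace_minus)

lemma trace_symplectic_self [simp]: "trace_symplectic u u = 0"
  by (simp add: trace_symplectic_def scalar_product_def mult.commute)

lemma trace_symplectic_0_right [simp]: "trace_symplectic u 0 = 0"
  using trace_symplectic_add_right[of u 0 0] by (metis add.right_neutral add_left_cancel)

lemma trace_symplectic_0_left [simp]: "trace_symplectic 0 u = 0"
  by (subst trace_symplectic_swap) simp

lemma trace_symplectic_minus_right: "trace_symplectic u (- v) = - trace_symplectic u v"
  using trace_symplectic_add_right[of u v "- v"] by (simp add: eq_neg_iff_add_eq_0 add.commute)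

lemma trace_symplectic_orth_sym: "trace_symplectic u v = 0 \<longleftrightarrow> trace_symplectic v u = 0"
  by (subst trace_symplectic_swap) simp

lemma symplectic_dual_iff: "v \<in> symplectic_dual C \<longleftrightarrow> (\<forall>u\<in>C. trace_symplectic v u = 0)"
  unfolding symplectic_dual_def using trace_symplectic_orth_sym by blast

lemma symplectic_dual_antimono: "C \<subseteq> C' \<Longrightarrow> symplectic_dual C' \<subseteq> symplectic_dual C"
  by (auto simp: symplectic_dual_def)

lemma subset_symplectic_dual_dual: "C \<subseteq> symplectic_dual (symplectic_dual C)"
  unfolding symplectic_dual_def using trace_symplectic_orth_sym by blast

lemma additive_code_kernel:
  assumes "additive_code H"
  shows "additive_code {v\<in>H. trace_symplectic u v = 0}"
  using assms
  by (auto simp: additive_code_def trace_symplectic_add_right trace_symplectic_minus_right)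

lemma additive_code_UNIV: "additive_code UNIV"
  by (simp add: additive_code_def)

lemma additive_code_symplectic_dual: "additive_code (symplectic_dual C)"
  by (auto simp: symplectic_dual_def additive_code_def trace_symplectic_add_right
      trace_symplectic_minus_right)

lemma additive_code_Int: "additive_code C \<Longrightarrow> additive_code C' \<Longrightarrow> additive_code (C \<inter> C')"
  by (auto simp: additive_code_def)

lemma subset_dual_radical: "C \<subseteq> symplectic_dual (symplectic_radical C)"
  using symplectic_dual_antimono[of "symplectic_radical C" "symplectic_dual C"]
    subset_symplectic_dual_dual[of C]
  by (auto simp: symplectic_radical_def)

lemma min_swt_antimono:
  assumes "S \<subseteq> T" "S - {0} \<noteq> {}"
  shows "min_swt T \<le> min_swt (S :: (('a::{zero,finite} ^ 'n) \<times> ('a ^ 'n)) set)"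
  unfolding min_swt_def using assms by (intro Min_antimono) auto

lemma min_swt_le:
  "v \<in> S \<Longrightarrow> v \<noteq> 0 \<Longrightarrow> min_swt (S :: (('a::{zero,finite} ^ 'n) \<times> ('a ^ 'n)) set) \<le> swt v"
  unfolding min_swt_def by (intro Min_le) auto

section \<open>Frobenius invariance and nonvanishing of the trace\<close>

context
  fixes p m :: nat
  assumes prime: "prime p" and CARD: "CARD('a::finite_field) = p ^ m"
begin

lemma CHAR_eq: "CHAR('a) = p"
proof -
  have "CHAR('a) dvd p ^ m"
    using CHAR_dvd_CARD[where ?'a = 'a] CARD by simp
  then show "CHAR('a) = p"
    using CHAR_prime[where ?'a = 'a] prime by (metis prime_dvd_power primes_dvd_imp_eq)
qed

lemma exponent_pos: "m > 0"
proof -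
  have "card {0, 1 :: 'a} \<le> CARD('a)"
    by (rule card_mono) auto
  then show "m > 0"
    using CARD by (cases m) auto
qed

lemma field_trace_eq: "field_trace (x :: 'a) = (\<Sum>i<m. x ^ (p ^ i))"
  using prime by (simp add: field_trace_def CHAR_eq CARD multiplicity_same_power)

text \<open>Frobenius shifts the summands by one place, and \<open>x ^ (p ^ m) = x\<close> closes
  the cycle. Hence traces lie in the prime subfield.\<close>

lemma field_trace_power_CHAR: "field_trace (x :: 'a) ^ CHAR('a) = field_trace x"
proof -
  have "field_trace x ^ CHAR('a) = (\<Sum>i<m. (x ^ (p ^ i)) ^ CHAR('a))"
    unfolding field_trace_eq by (rule freshmans_dream_sum) simp_all
  also have "\<dots> = (\<Sum>i<m. x ^ (p ^ Suc i))"
    by (simp add: CHAR_eq mult.commute flip: power_mult)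
  finally have "field_trace x ^ CHAR('a) = (\<Sum>i<m. x ^ (p ^ Suc i))" .
  moreover have "(\<Sum>i<m. x ^ (p ^ Suc i)) + x ^ (p ^ 0) = (\<Sum>i<m. x ^ (p ^ i)) + x ^ (p ^ m)"
    using sum.lessThan_Suc_shift[of "\<lambda>i. x ^ (p ^ i)" m]
    by (simp add: add.commute)
  moreover have "x ^ (p ^ m) = x"
    using finite_field_power_card_eq_same[of x] CARD by simp
  ultimately show ?thesis
    by (simp add: field_trace_eq del: power_Suc)
qed

text \<open>The trace is a polynomial of degree \<open>p ^ (m - 1)\<close>, so it cannot vanish on all of \<open>'a\<close>.\<close>

lemma field_trace_nonzero:
  obtains x :: 'a where "field_trace x \<noteq> 0"
proof (rule ccontr)
  have p2: "p \<ge> 2"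
    using prime prime_ge_2_nat by blast
  define P where "P = (\<Sum>i<m. monom (1::'a) (p ^ i))"
  assume "\<not> thesis"
  then have "field_trace x = 0" for x :: 'a
    using that by blast
  then have "poly P x = 0" for x
    by (simp add: P_def poly_sum poly_monom field_trace_eq)
  then have roots: "{x. poly P x = 0} = UNIV"
    by auto
  \<comment> \<open>Distinct \<open>i\<close> give distinct exponents \<open>p ^ i\<close>, so only
    the last monomial contributes.\<close>
  have "coeff P (p ^ (m - 1)) = (\<Sum>i<m. if i = m - 1 then 1 else 0)"
    unfolding P_def coeff_sum using p2
    by (intro sum.cong) (auto simp: power_inject_exp)
  also have "\<dots> = 1"
    using exponent_pos by simp
  finally have "P \<noteq> 0"
    by auto
  have "degree P \<le> p ^ (m - 1)"
    unfolding P_def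
  proof (rule degree_sum_le)
    fix i assume "i \<in> {..<m}"
    then have "p ^ i \<le> p ^ (m - 1)"
      using p2 by (intro power_increasing) auto
    then show "degree (monom (1::'a) (p ^ i)) \<le> p ^ (m - 1)"
      by (simp add: degree_monom_eq)
  qed simp
  also have "\<dots> < p ^ m"
    using p2 exponent_pos by (intro power_strict_increasing) auto
  finally show False
    using card_poly_roots_bound[OF \<open>P \<noteq> 0\<close>] CARD roots by simp
qed

section \<open>Nondegeneracy of the form and sizes of duals\<close>

lemma card_eq_kernel:
  fixes H :: "(('a ^ 'n) \<times> ('a ^ 'n)) set"
  assumes "additive_code H" "w \<in> H" "trace_symplectic u w \<noteq> 0"
  shows "card H = p * card {v\<in>H. trace_symplectic u v = 0}"
proof -
  have "trace_symplectic u v ^ CHAR('a) = trace_symplectic u v" for v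
    by (simp add: trace_symplectic_def field_trace_power_CHAR)
  then show ?thesis
    using card_additive_code_eq_kernel[of H "trace_symplectic u" w] assms
    by (simp add: trace_symplectic_add_right CHAR_eq)
qed

text \<open>A nonzero coordinate of \<open>u\<close> is paired with a vector supported at the same
  index of the opposite half, scaled so that the product is an element of nonzero trace.\<close>

lemma trace_symplectic_nondegenerate:
  fixes u :: "('a ^ 'n) \<times> ('a ^ 'n)"
  assumes "u \<noteq> 0"
  obtains v where "trace_symplectic u v \<noteq> 0"
proof -
  obtain t :: 'a where t: "field_trace t \<noteq> 0"
    by (rule field_trace_nonzero)
  have delta: "scalar_product x (\<chi> j. if j = i then c else 0) = x $ i * c"
    "scalar_product (\<chi> j. if j = i then c else 0) x = x $ i * c" for x :: "'a ^ 'n" and i c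
    by (simp_all add: scalar_product_def if_distrib[of "(*) _"] if_distrib[of "\<lambda>z. z * _"]
        mult.commute cong: if_cong)
  from assms consider i where "fst u $ i \<noteq> 0" | i where "snd u $ i \<noteq> 0"
    by (auto simp: prod_eq_iff vec_eq_iff)
  then show thesis
  proof cases
    case 1
    then have "trace_symplectic u (0, \<chi> j. if j = i then - t / fst u $ i else 0) = field_trace t"
      by (simp add: trace_symplectic_def delta) (simp add: scalar_product_def)
    with t that show thesis by metis
  next
    case 2
    then have "trace_symplectic u (\<chi> j. if j = i then t / snd u $ i else 0, 0) = field_trace t"
      by (simp add: trace_symplectic_def delta) (simp add: scalar_product_def)
    with t that show thesis by metis
  qed
qed

text \<open>Count the orthogonal pairs in \<open>C \<times> UNIV\<close> by each coordinate.\<close>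

lemma card_symplectic_dual:
  fixes C :: "(('a ^ 'n::finite) \<times> ('a ^ 'n)) set"
  assumes C: "additive_code C"
  shows "card C * card (symplectic_dual C) = CARD('a) ^ (2 * CARD('n))"
proof -
  let ?V = "UNIV :: (('a ^ 'n) \<times> ('a ^ 'n)) set"
  let ?N = "\<Sum>u\<in>C. card {v\<in>?V. trace_symplectic u v = 0}"
  have p2: "p \<ge> 2"
    using prime prime_ge_2_nat by blast
  have C0: "0 \<in> C"
    using C by (simp add: additive_code_def)
  have V: "card ?V = CARD('a) ^ (2 * CARD('n))"
    by (simp add: card_cartesian_product mult_2 power_add flip: UNIV_Times_UNIV)
  \<comment> \<open>Counts are scaled by \<open>p\<close> so that the index formula applies without
    division.\<close>
  have row: "p * card {v\<in>?V. trace_symplectic u v = 0} =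
      (if u = 0 then p * card ?V else card ?V)" for u
  proof (cases "u = 0")
    case False
    then obtain w where "trace_symplectic u w \<noteq> 0"
      by (rule trace_symplectic_nondegenerate)
    then show ?thesis
      using False card_eq_kernel[OF additive_code_UNIV, of w u] by simp
  qed simp
  have "p * ?N = (\<Sum>u\<in>C. if u = 0 then p * card ?V else card ?V)"
    unfolding sum_distrib_left row ..
  also have "\<dots> = p * card ?V + (card C - 1) * card ?V"
    using C0 by (simp add: sum.remove[of C 0] card_Diff_singleton)
  finally have rows: "p * ?N = p * card ?V + (card C - 1) * card ?V" .
  have col: "p * card {u\<in>C. trace_symplectic v u = 0} =
      (if v \<in> symplectic_dual C then p * card C else card C)" for v
  proof (cases "v \<in> symplectic_dual C")
    case True
    then have "{u\<in>C. trace_symplectic v u = 0} = C"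
      by (auto simp: symplectic_dual_iff)
    then show ?thesis
      using True by simp
  next
    case False
    then obtain w where "w \<in> C" "trace_symplectic v w \<noteq> 0"
      by (auto simp: symplectic_dual_iff)
    then show ?thesis
      using False card_eq_kernel[OF C] by simp
  qed
  have "?N = (\<Sum>v\<in>?V. card {u\<in>C. trace_symplectic v u = 0})"
    using sum.swap_restrict[of C ?V "\<lambda>_ _. 1 :: nat" "\<lambda>u v. trace_symplectic u v = 0"]
    by (simp add: trace_symplectic_orth_sym[of _ v for v])
  then have "p * ?N = (\<Sum>v\<in>?V. if v \<in> symplectic_dual C then p * card C else card C)"
    by (simp only: sum_distrib_left col)
  also have "\<dots> = card (symplectic_dual C) * (p * card C) +
      card (?V - symplectic_dual C) * card C"
    by (simp add: sum.If_cases Compl_eq_Diff_UNIV)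
  also have "card (?V - symplectic_dual C) = card ?V - card (symplectic_dual C)"
    by (simp add: card_Diff_subset)
  finally have cols: "p * ?N = card (symplectic_dual C) * (p * card C) +
      (card ?V - card (symplectic_dual C)) * card C" .
  have "card C > 0"
    using C0 by (auto simp: card_gt_0_iff)
  moreover have "card (symplectic_dual C) \<le> card ?V"
    by (rule card_mono) simp_all
  ultimately obtain c e where c: "card C = Suc c" and e: "card ?V = card (symplectic_dual C) + e"
    by (metis gr0_conv_Suc le_add_diff_inverse)
  \<comment> \<open>Like \<open>c\<close> and \<open>e\<close>, writing \<open>p - 1\<close> as
    \<open>Suc r\<close> avoids truncated subtraction. Comparing the two counts and cancelling
    \<open>Suc r\<close> leaves \<open>e = c * card (symplectic_dual C)\<close>.\<close>
  obtain r where r: "p = Suc (Suc r)"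
    using p2 by (auto simp: numeral_2_eq_2 Suc_le_D dest: le_Suc_ex)
  have "Suc r * e = Suc r * (c * card (symplectic_dual C))"
    using rows cols unfolding c e r by (simp add: algebra_simps)
  then have "card C * card (symplectic_dual C) = card ?V"
    unfolding c e by (simp only: mult_cancel1) simp
  then show ?thesis
    unfolding V .
qed

text \<open>One inclusion always holds; the size formula for \<open>C\<close> and for its dual makes
  the two sides equally large.\<close>

lemma symplectic_dual_dual:
  fixes C :: "(('a ^ 'n::finite) \<times> ('a ^ 'n)) set"
  assumes "additive_code C"
  shows "symplectic_dual (symplectic_dual C) = C"
proof -
  have "card C * card (symplectic_dual C) =
      card (symplectic_dual C) * card (symplectic_dual (symplectic_dual C))"
    using card_symplectic_dual[OF assms]
      card_symplectic_dual[OF additive_code_symplectic_dual[of C]] by simp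
  moreover have "card (symplectic_dual C) > 0"
    using additive_code_symplectic_dual[of C] by (auto simp: card_gt_0_iff additive_code_def)
  ultimately have "card (symplectic_dual (symplectic_dual C)) = card C"
    by auto
  then show ?thesis
    using card_subset_eq[OF _ subset_symplectic_dual_dual[of C]] by simp
qed

text \<open>
  Adjoins to \<open>C\<close> a hyperbolic pair \<open>z\<close>, \<open>w\<close> of \<open>symplectic_dual C\<close>. The enlarged code is the dual
  of \<open>E\<close>, the part of \<open>symplectic_dual C\<close> orthogonal to \<open>z\<close> and \<open>w\<close>, so that its size follows from
  kernel counts alone.
\<close>

lemma symplectic_extension:
  fixes C :: "(('a ^ 'n::finite) \<times> ('a ^ 'n)) set"
  assumes C: "additive_code C" and not_sub: "\<not> symplectic_dual C \<subseteq> C"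
  obtains C' where "additive_code C'" "C \<subseteq> C'" "symplectic_radical C' = symplectic_radical C"
    "card C' = p\<^sup>2 * card C"
proof -
  let ?D = "symplectic_dual C"
  let ?K = "\<lambda>H u. {v\<in>H. trace_symplectic u v = 0}"
  have D: "additive_code ?D"
    by (rule additive_code_symplectic_dual)
  have dual_D: "symplectic_dual ?D = C"
    by (rule symplectic_dual_dual[OF C])
  \<comment> \<open>By double duality \<open>z\<close> is outside \<open>C\<close>, so some
    \<open>w\<close> in \<open>?D\<close> is not orthogonal to it.\<close>
  obtain z where z: "z \<in> ?D" "z \<notin> symplectic_dual ?D"
    using not_sub dual_D by blast
  then obtain w where w: "w \<in> ?D" "trace_symplectic z w \<noteq> 0" "trace_symplectic w z \<noteq> 0"
    using trace_symplectic_orth_sym[of z] by (auto simp: symplectic_dual_iff[of z])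
  define E where "E = ?K (?K ?D z) w"
  have E: "additive_code E"
    unfolding E_def by (intro additive_code_kernel D)
  \<comment> \<open>Orthogonality to \<open>z\<close> cuts out index \<open>p\<close>, witnessed by
    \<open>w\<close>; orthogonality to \<open>w\<close> does so again, witnessed by
    \<open>z\<close>, which is orthogonal to itself.\<close>
  have "card ?D = p * card (?K ?D z)"
    by (rule card_eq_kernel[OF D w(1,2)])
  also have "card (?K ?D z) = p * card E"
    unfolding E_def by (rule card_eq_kernel[OF _ _ w(3)]) (auto intro: additive_code_kernel D z)
  finally have card_E: "card ?D = p\<^sup>2 * card E"
    by (simp add: power2_eq_square)
  have E_pos: "card E > 0"
    using E by (auto simp: card_gt_0_iff additive_code_def)
  have dual_E: "symplectic_dual (symplectic_dual E) = E"
    by (rule symplectic_dual_dual[OF E])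
  have "E \<subseteq> ?D"
    by (auto simp: E_def)
  then have C_sub: "C \<subseteq> symplectic_dual E"
    using symplectic_dual_antimono dual_D by blast
  have "card C * card ?D = card E * card (symplectic_dual E)"
    using card_symplectic_dual[OF C] card_symplectic_dual[OF E] by simp
  then have card_E_dual: "card (symplectic_dual E) = p\<^sup>2 * card C"
    using E_pos unfolding card_E by (auto simp: mult.commute)
  \<comment> \<open>Otherwise orthogonality to \<open>v\<close> and then to \<open>z\<close> would
    cut out of \<open>?D\<close> a group of the size of \<open>E\<close> containing both
    \<open>E\<close> and \<open>z\<close>. But \<open>z\<close> is not orthogonal to
    \<open>w\<close>.\<close>
  have "E \<inter> symplectic_dual E \<subseteq> C"
  proof
    fix v assume v: "v \<in> E \<inter> symplectic_dual E"
    show "v \<in> C"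
    proof (rule ccontr)
      assume "v \<notin> C"
      then obtain x where x: "x \<in> ?D" "trace_symplectic v x \<noteq> 0"
        by (subst (asm) dual_D[symmetric]) (auto simp: symplectic_dual_iff[of v])
      let ?G = "?K ?D v"
      have G: "additive_code ?G"
        by (rule additive_code_kernel[OF D])
      have zw: "z \<in> ?G" "w \<in> ?G"
        using v z w trace_symplectic_orth_sym[of v] by (auto simp: E_def)
      have "card ?D = p * card ?G"
        by (rule card_eq_kernel[OF D x])
      also have "card ?G = p * card (?K ?G z)"
        by (rule card_eq_kernel[OF G zw(2) w(2)])
      finally have "card ?D = p\<^sup>2 * card (?K ?G z)"
        by (simp add: power2_eq_square)
      then have "card E = card (?K ?G z)"
        using card_E prime by (auto simp: prime_gt_0_nat)
      moreover have "E \<subseteq> ?K ?G z"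
        using v by (auto simp: E_def symplectic_dual_iff[of v])
      ultimately have "E = ?K ?G z"
        by (intro card_subset_eq) auto
      then have "z \<in> E"
        using zw by auto
      then show False
        using w by (simp add: E_def)
    qed
  qed
  moreover have "C \<inter> ?D \<subseteq> E"
    using z(1) w(1) by (auto simp: E_def symplectic_dual_iff[of z] symplectic_dual_iff[of w])
  ultimately have "symplectic_radical (symplectic_dual E) = symplectic_radical C"
    using C_sub \<open>E \<subseteq> ?D\<close> unfolding symplectic_radical_def dual_E by blast
  then show thesis
    using that[OF additive_code_symplectic_dual C_sub _ card_E_dual] by blast
qed

section \<open>Arithmetic of the parameters of a subsystem code\<close>

text \<open>Clears the real quotients of the definition. The sixth fact measures the gap between
  \<open>C\<close> and the dual of its radical; the seventh makes \<open>K\<close> divide a power of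
  \<open>p\<close>.\<close>

lemma subsystem_code_cards:
  fixes C :: "(('a ^ 'n::finite) \<times> ('a ^ 'n)) set"
  assumes "subsystem_code C K R d"
  shows "K > 0" "R > 0" "K * card C = CARD('a) ^ CARD('n) * R"
    "K * R * card (symplectic_radical C) = CARD('a) ^ CARD('n)"
    "card (symplectic_dual (symplectic_radical C)) = CARD('a) ^ CARD('n) * K * R"
    "card (symplectic_dual (symplectic_radical C)) = K\<^sup>2 * card C"
    "K\<^sup>2 * (card C * card (symplectic_radical C)) = p ^ (2 * m * CARD('n))"
proof -
  let ?D = "symplectic_radical C" and ?Q = "CARD('a) ^ CARD('n)"
  have C: "additive_code C"
    and cardC: "real (card C) = real ?Q * real R / real K"
    and cardD: "real (card ?D) = real ?Q / (real K * real R)"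
    using assms by (simp_all add: subsystem_code_def)
  have D: "additive_code ?D"
    unfolding symplectic_radical_def by (intro additive_code_Int C additive_code_symplectic_dual)
  have "card ?D > 0"
    using D by (auto simp: card_gt_0_iff additive_code_def)
  with cardD show K: "K > 0" and R: "R > 0"
    by (auto intro!: Nat.gr0I)
  have "real (K * card C) = real (?Q * R)"
    using cardC K by (simp add: field_simps)
  then show KC: "K * card C = ?Q * R"
    by (simp only: of_nat_eq_iff)
  have "real (K * R * card ?D) = real ?Q"
    using cardD K R by (simp add: field_simps)
  then show KD: "K * R * card ?D = ?Q"
    by (simp only: of_nat_eq_iff)
  have "card ?D * card (symplectic_dual ?D) = ?Q * ?Q"
    using card_symplectic_dual[OF D] by (simp add: mult_2 power_add)
  also have "\<dots> = card ?D * (?Q * K * R)"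
    by (subst KD[symmetric]) (simp add: mult_ac)
  finally show dual: "card (symplectic_dual ?D) = ?Q * K * R"
    using \<open>card ?D > 0\<close> by auto
  show "card (symplectic_dual ?D) = K\<^sup>2 * card C"
    using KC dual by (simp add: power2_eq_square mult_ac)
  have "K\<^sup>2 * (card C * card ?D) * R = (K * card C) * (K * R * card ?D)"
    by (simp add: power2_eq_square mult_ac)
  also have "\<dots> = ?Q * ?Q * R"
    unfolding KC KD by simp
  finally have "K\<^sup>2 * (card C * card ?D) = ?Q * ?Q"
    using R by simp
  then show "K\<^sup>2 * (card C * card ?D) = p ^ (2 * m * CARD('n))"
    unfolding CARD by (simp add: mult_2 power_add distrib_right flip: power_mult)
qed

lemma dvd_of_subsystem_code:
  fixes C :: "(('a ^ 'n::finite) \<times> ('a ^ 'n)) set"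
  assumes "subsystem_code C K R d" "K > 1"
  shows "p dvd K"
proof -
  have "K dvd p ^ (2 * m * CARD('n))"
    unfolding subsystem_code_cards(7)[OF assms(1), symmetric] by (simp add: power2_eq_square)
  then obtain i where "K = p ^ i"
    using prime by (auto simp: divides_primepow_nat)
  then show ?thesis
    using assms(2) by (cases i) auto
qed

section \<open>The enlarged codes for \<open>K > p\<close> and for \<open>K = p\<close>\<close>

text \<open>The radical is kept, so every new element lies in its dual but outside \<open>C\<close>,
  where weights are at least \<open>d\<close>. This controls both distance and purity.\<close>

lemma subsystem_code_extension:
  fixes C :: "(('a ^ 'n::finite) \<times> ('a ^ 'n)) set"
  assumes code: "subsystem_code C K R d" and pure: "pure_to C d'" and K: "K > p"
  shows "\<exists>(C' :: (('a ^ 'n) \<times> ('a ^ 'n)) set) d''.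
    d'' \<ge> d \<and> subsystem_code C' (K div p) (p * R) d'' \<and> pure_to C' (min d d')"
proof -
  let ?D = "symplectic_radical C"
  note cards = subsystem_code_cards[OF code]
  have C: "additive_code C" and d: "d = code_distance C"
    using code by (simp_all add: subsystem_code_def)
  have p1: "p > 1"
    using prime prime_gt_1_nat by blast
  obtain k where k: "K = p * k"
    using dvd_of_subsystem_code[OF code] K p1 by auto
  have k1: "k > 1"
    using K unfolding k by simp
  have C_pos: "card C > 0"
    using C by (auto simp: card_gt_0_iff additive_code_def)
  have D_dual: "symplectic_dual ?D \<noteq> C"
  proof
    assume "symplectic_dual ?D = C"
    then have "K\<^sup>2 = 1"
      using cards(6) C_pos by (metis mult_1 mult_cancel2 not_gr_zero)
    then show False
      using K p1 by (simp add: power2_eq_square)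
  qed
  \<comment> \<open>If the dual were inside \<open>C\<close>, it would be the radical, whose dual is
    then \<open>C\<close>.\<close>
  have "\<not> symplectic_dual C \<subseteq> C"
  proof
    assume "symplectic_dual C \<subseteq> C"
    then have "symplectic_dual ?D = C"
      using symplectic_dual_dual[OF C] by (simp add: symplectic_radical_def Int_absorb1)
    with D_dual show False ..
  qed
  then obtain C' where C': "additive_code C'" "C \<subseteq> C'" "symplectic_radical C' = ?D"
    "card C' = p\<^sup>2 * card C"
    by (rule symplectic_extension[OF C])
  have C'_sub: "C' \<subseteq> symplectic_dual ?D"
    using subset_dual_radical[of C'] C'(3) by simp
  \<comment> \<open>The sizes are \<open>p\<^sup>2 * card C\<close> and
    \<open>p\<^sup>2 * k\<^sup>2 * card C\<close> with \<open>k > 1\<close>. Hence the distance of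
    \<open>C'\<close> is a minimum over \<open>symplectic_dual ?D - C'\<close>.\<close>
  have C'_dual: "C' \<noteq> symplectic_dual ?D"
    using C'(4) cards(6) C_pos k1 p1 by (auto simp: k power_mult_distrib)
  have d_eq: "d = min_swt (symplectic_dual ?D - C)"
    using D_dual by (simp add: d code_distance_def Let_def)
  \<comment> \<open>As \<open>C'\<close> contains 0, the smaller set difference has a nonzero
    element, so its minimum weight is a genuine minimum.\<close>
  have "0 \<in> C'"
    using C' by (simp add: additive_code_def)
  then have ge: "d \<le> code_distance C'"
    unfolding d_eq using C'_dual C'_sub C'(2)
    by (auto simp: code_distance_def C'(3) Let_def intro!: min_swt_antimono)
  have pure': "pure_to C' (min d d')"
    unfolding pure_to_def
  proof (intro ballI impI)
    fix v assume v: "v \<in> C'" "v \<noteq> 0"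
    show "min d d' \<le> swt v"
    proof (cases "v \<in> C")
      case True
      then show ?thesis
        using pure v by (auto simp: pure_to_def)
    next
      case False
      then have "d \<le> swt v"
        unfolding d_eq using v C'_sub by (intro min_swt_le) auto
      then show ?thesis
        by simp
    qed
  qed
  have "real K * real (card C) = real CARD('a) ^ CARD('n) * real R"
    using arg_cong[OF cards(3), of real] by simp
  then have "real (card C') = real CARD('a) ^ CARD('n) * real (p * R) / real (K div p)"
    using p1 k1 by (simp add: k C'(4) field_simps power2_eq_square)
  moreover have "real K * real R * real (card ?D) = real CARD('a) ^ CARD('n)"
    using arg_cong[OF cards(4), of real] by simp
  then have "real (card ?D) = real CARD('a) ^ CARD('n) / (real (K div p) * real (p * R))"
    using p1 k1 cards(2) by (simp add: k field_simps)
  ultimately have "subsystem_code C' (K div p) (p * R) (code_distance C')"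
    using C' by (simp add: subsystem_code_def)
  with ge pure' show ?thesis
    by blast
qed

text \<open>For \<open>K = p\<close> the dual of the radical has \<open>p\<^sup>2 * card C\<close>
  elements, the size of a code enlarged by one hyperbolic pair, so it is taken directly. Purity
  bounds the weights of the elements of \<open>C\<close> in it.\<close>

lemma pure_subsystem_code_extension:
  fixes C :: "(('a ^ 'n::finite) \<times> ('a ^ 'n)) set"
  assumes code: "subsystem_code C p R d" and pure: "pure_code C"
  shows "subsystem_code (symplectic_dual (symplectic_radical C)) 1 (p * R) d"
proof -
  let ?D = "symplectic_radical C"
  let ?C' = "symplectic_dual ?D"
  note cards = subsystem_code_cards[OF code]
  have C: "additive_code C" and d: "d = code_distance C"
    using code by (simp_all add: subsystem_code_def)
  have D: "additive_code ?D"
    unfolding symplectic_radical_def by (intro additive_code_Int C additive_code_symplectic_dual)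
  have p1: "p > 1"
    using prime prime_gt_1_nat by blast
  have C_pos: "card C > 0" and C0: "0 \<in> C"
    using C by (auto simp: card_gt_0_iff additive_code_def)
  have C'_C: "?C' \<noteq> C"
  proof
    assume "?C' = C"
    then have "p\<^sup>2 = 1"
      using cards(6) C_pos by (metis mult_1 mult_cancel2 not_gr_zero)
    then show False
      using p1 by (simp add: power2_eq_square)
  qed
  \<comment> \<open>Double duality makes \<open>?D\<close> the dual of \<open>?C'\<close>, and
    \<open>?D\<close> lies in \<open>C\<close>, hence in \<open>?C'\<close>.\<close>
  have radical: "symplectic_radical ?C' = ?D"
    using symplectic_dual_dual[OF D] subset_dual_radical[of C]
    by (auto simp: symplectic_radical_def)
  have d_eq: "d = min_swt (?C' - C)"
    using C'_C by (simp add: d code_distance_def Let_def)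
  \<comment> \<open>Rules out a \<open>Min\<close> of the empty set in both inequalities
    below.\<close>
  have nonempty: "?C' - C - {0} \<noteq> {}"
    using C'_C subset_dual_radical[of C] C0 by auto
  have "min_swt ?C' = d"
  proof (rule antisym)
    show "min_swt ?C' \<le> d"
      unfolding d_eq using nonempty by (intro min_swt_antimono) auto
    have "d \<le> swt v" if "v \<in> ?C'" "v \<noteq> 0" for v
    proof (cases "v \<in> C")
      case True
      then show ?thesis
        using pure that by (auto simp: pure_code_def pure_to_def d)
    next
      case False
      then show ?thesis
        unfolding d_eq using that by (intro min_swt_le) auto
    qed
    then show "d \<le> min_swt ?C'"
      unfolding min_swt_def using nonempty by (subst Min_ge_iff) auto
  qed
  \<comment> \<open>The dual of the radical of \<open>?C'\<close> is \<open>?C'\<close> itself, so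
    its distance is the minimum weight of the whole code.\<close>
  then have "d = code_distance ?C'"
    by (simp add: code_distance_def radical)
  moreover have "real (card ?C') = real CARD('a) ^ CARD('n) * real (p * R) / real 1"
    by (simp add: cards(5))
  moreover have "real p * real R * real (card ?D) = real CARD('a) ^ CARD('n)"
    using arg_cong[OF cards(4), of real] by simp
  then have "real (card ?D) = real CARD('a) ^ CARD('n) / (real 1 * real (p * R))"
    using p1 cards(2) by (simp add: field_simps)
  ultimately show ?thesis
    unfolding subsystem_code_def radical by (simp add: additive_code_symplectic_dual)
qed

end

theorem theorem10:
  fixes p q m n :: nat
  assumes "prime p" and "q = p ^ m"
    and "CARD('a::finite_field) = q" and "CARD('n::finite) = n"
  shows
    "(\<forall>K R d d'. K > p \<and>
        (\<exists>C :: (('a ^ 'n) \<times> ('a ^ 'n)) set. subsystem_code C K R d \<and> pure_to C d') \<longrightarrow>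
        p dvd K \<and>
        (\<exists>(C :: (('a ^ 'n) \<times> ('a ^ 'n)) set) d''.
           d'' \<ge> d \<and> subsystem_code C (K div p) (p * R) d'' \<and> pure_to C (min d d'))) \<and>
     (\<forall>R d.
        (\<exists>C :: (('a ^ 'n) \<times> ('a ^ 'n)) set. subsystem_code C p R d \<and> pure_code C) \<longrightarrow>
        (\<exists>C :: (('a ^ 'n) \<times> ('a ^ 'n)) set. subsystem_code C 1 (p * R) d))"
proof -
  have CARD: "CARD('a) = p ^ m"
    using assms by simp
  have p1: "p > 1"
    using assms(1) prime_gt_1_nat by blast
  show ?thesis
    using dvd_of_subsystem_code[OF assms(1) CARD] subsystem_code_extension[OF assms(1) CARD]
      pure_subsystem_code_extension[OF assms(1) CARD] p1
    by (meson less_trans)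
qed

end
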